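(* Let $\mathcal{K}$ be a complete idempotent semiring and $X$ a complete right $\mathcal{K}$-semimodule. Let $W\subset X^2$ be a complete congruence. Assume that $s,t\in X$ are such that $(s,t)\notin W$. Then there exists $x\in X$ such that $$(f,g)\in W\implies f\backslash x=g\backslash x$$ and $$s\backslash x\neq t\backslash x.$$
   Context: An idempotent semiring $(\mathcal{K},\oplus,\otimes,\varepsilon,e)$ is ordered by the natural order $a\leq b\iff a\oplus b=b$; $\vee Q$ denotes the least upper bound of $Q$. A map $F$ between ordered sets in which every subset has a least upper bound is continuous if $F(\vee Q)=\vee F(Q)$ for all subsets $Q$. $\mathcal{K}$ is complete if every subset has a least upper bound and all left and right multiplications $b\mapsto ab$, $b\mapsto ba$ are continuous. A right $\mathcal{K}$-semimodule $X$ is a commutative monoid $(X,\oplus,\varepsilon)$ with a right action satisfying $(x\oplus z)\lambda=x\lambda\oplus z\lambda$, $x(\lambda\oplus\mu)=x\lambda\oplus x\mu$, $x(\lambda\mu)=(x\lambda)\mu$, $x\varepsilon=\varepsilon$, $\varepsilon\lambda=\varepsilon$, $xe=x$; it is then idempotent and naturally ordered by $x\le z\iff x\oplus z=z$. $X$ is complete if every subset has a least upper bound and the maps $X\to X,\ z\mapsto z\lambda$ and $\mathcal{K}\to X,\ \mu\mapsto u\mu$ are continuous for all $\lambda\in\mathcal{K}$, $u\in X$. For $u,x\in X$, $u\backslash x:=\vee\{\mu\in\mathcal{K}\mid u\mu\leq x\}$. A subsemimodule is a subset stable under all $x\lambda\oplus z\mu$; it is complete if it contains $\vee Q$ for each of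 its subsets $Q$. $X^2$ carries componentwise operations. A congruence is a subsemimodule $W\subset X^2$ which is an equivalence relation on $X$ (reflexive, symmetric, transitive). A complete congruence is one that is complete as a subsemimodule of $X^2$. *)

theory Defs
  imports Main "HOL-Library.Product_Plus" "HOL-Library.Product_Order"
begin

text \<open>
  \<open>\<oplus>\<close>, \<open>\<otimes>\<close>, \<open>\<epsilon>\<close>, \<open>e\<close> are the type class operations \<open>+\<close>, \<open>*\<close>, \<open>0\<close>, \<open>1\<close>. The class
  \<^class>\<open>semiring_1\<close> is avoided because it imposes \<open>0 \<noteq> 1\<close>.
\<close>

class idempotent_semiring = semiring_0 + monoid_mult + order +
  assumes add_idem: "a + a = a"
    and natural_order: "a \<le> b \<longleftrightarrow> a + b = b"

text \<open>
  Only least upper bounds are required of a complete semiring. They determine the remaining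
  operations of \<^class>\<open>complete_lattice\<close>, which therefore add no hypothesis.
\<close>

class complete_idempotent_semiring = idempotent_semiring + complete_lattice +
  assumes mult_Sup_left: "a * Sup Q = Sup ((\<lambda>b. a * b) ` Q)"
    and mult_Sup_right: "Sup Q * a = Sup ((\<lambda>b. b * a) ` Q)"

locale right_semimodule =
  fixes act :: "'x::comm_monoid_add \<Rightarrow> 'k::idempotent_semiring \<Rightarrow> 'x"  (infixl "\<cdot>" 70)
  assumes act_add_left: "(x + z) \<cdot> l = x \<cdot> l + z \<cdot> l"
    and act_add_right: "x \<cdot> (l + m) = x \<cdot> l + x \<cdot> m"
    and act_mult: "x \<cdot> (l * m) = (x \<cdot> l) \<cdot> m"
    and act_zero_right: "x \<cdot> 0 = 0"
    and act_zero_left: "0 \<cdot> l = 0"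
    and act_one: "x \<cdot> 1 = x"
begin

lemma add_idem: "x + x = (x::'x)"
  using act_add_right[of x 1 1] by (simp add: idempotent_semiring_class.add_idem act_one)

end

text \<open>The first assumption ties the order of the type \<open>'x\<close> to the natural order of \<open>+\<close>.\<close>

locale complete_right_semimodule = right_semimodule act
  for act :: "'x::{comm_monoid_add, complete_lattice} \<Rightarrow> 'k::complete_idempotent_semiring \<Rightarrow> 'x"
    (infixl "\<cdot>" 70) +
  assumes natural_order: "x \<le> z \<longleftrightarrow> x + z = (z::'x)"
    and act_Sup_left: "Sup Q \<cdot> l = Sup ((\<lambda>z. z \<cdot> l) ` Q)"
    and act_Sup_right: "u \<cdot> Sup M = Sup ((\<lambda>m. u \<cdot> m) ` M)"

definition residual ::
    "('x::complete_lattice \<Rightarrow> 'k::complete_lattice \<Rightarrow> 'x) \<Rightarrow> 'x \<Rightarrow> 'x \<Rightarrow> 'k" where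
  "residual act u x = Sup {m. act u m \<le> x}"

definition subsemimodule :: "('x::plus \<Rightarrow> 'k \<Rightarrow> 'x) \<Rightarrow> 'x set \<Rightarrow> bool" where
  "subsemimodule act S \<longleftrightarrow> (\<forall>x\<in>S. \<forall>z\<in>S. \<forall>l m. act x l + act z m \<in> S)"

definition complete_subsemimodule ::
    "('x::{plus, complete_lattice} \<Rightarrow> 'k \<Rightarrow> 'x) \<Rightarrow> 'x set \<Rightarrow> bool" where
  "complete_subsemimodule act S \<longleftrightarrow> subsemimodule act S \<and> (\<forall>Q. Q \<subseteq> S \<longrightarrow> Sup Q \<in> S)"

text \<open>
  Addition and order on pairs are the componentwise ones of \<^theory>\<open>HOL-Library.Product_Plus\<close>
  and \<^theory>\<open>HOL-Library.Product_Order\<close>.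
\<close>

definition prod_act :: "('x \<Rightarrow> 'k \<Rightarrow> 'x) \<Rightarrow> 'x \<times> 'x \<Rightarrow> 'k \<Rightarrow> 'x \<times> 'x" where
  "prod_act act p l = (act (fst p) l, act (snd p) l)"

definition congruence :: "('x::plus \<Rightarrow> 'k \<Rightarrow> 'x) \<Rightarrow> ('x \<times> 'x) set \<Rightarrow> bool" where
  "congruence act W \<longleftrightarrow> subsemimodule (prod_act act) W \<and> equiv UNIV W"

definition complete_congruence ::
    "('x::{plus, complete_lattice} \<Rightarrow> 'k \<Rightarrow> 'x) \<Rightarrow> ('x \<times> 'x) set \<Rightarrow> bool" where
  "complete_congruence act W \<longleftrightarrow> congruence act W \<and> complete_subsemimodule (prod_act act) W"

text \<open>
  The product order is the natural order of the componentwise addition, and its suprema are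
  the ones meant by completeness in \<open>X\<^sup>2\<close>:
\<close>

lemma (in complete_right_semimodule) complete_right_semimodule_prod_act:
  "complete_right_semimodule (prod_act act)"
  by unfold_locales
    (auto simp: prod_act_def act_add_left act_add_right act_mult act_zero_left act_zero_right
      act_one natural_order less_eq_prod_def prod_eq_iff act_Sup_left act_Sup_right
      fst_Sup snd_Sup image_image)

end

theory Submission
  imports Defs
begin

text \<open>
  Every class of \<open>W\<close> has a greatest element. If \<open>x\<close> is the greatest element of its class and
  \<open>(f, g) \<in> W\<close>, then \<open>f\<mu> \<le> x\<close> makes \<open>g\<mu> \<oplus> x\<close> equivalent to \<open>f\<mu> \<oplus> x = x\<close>, so \<open>g\<mu> \<le> x\<close>; hence
  \<open>f\<setminus>x = g\<setminus>x\<close>. Let \<open>x\<close> and \<open>y\<close> be the greatest elements of the classes of \<open>s\<close> and \<open>t\<close>. If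
  neither separated \<open>s\<close> from \<open>t\<close>, then \<open>t \<le> x\<close> and \<open>s \<le> y\<close>, and adding the pairs \<open>(x, s)\<close> and
  \<open>(t, y)\<close> of \<open>W\<close> would give \<open>(x, y) \<in> W\<close>, that is, \<open>(s, t) \<in> W\<close>.
\<close>

definition class_top :: "('x::complete_lattice \<times> 'x) set \<Rightarrow> 'x \<Rightarrow> 'x" where
  "class_top W x = Sup {z. (z, x) \<in> W}"

context complete_right_semimodule
begin

text \<open>Continuity of the action makes the supremum attained:
  \<open>u \<cdot> residual act u x \<le> x\<close>. Hence elements with equal residuals at
  \<open>x\<close> are both below \<open>x\<close> or both not.\<close>

lemma one_le_residual_iff: "1 \<le> residual act u x \<longleftrightarrow> u \<le> x"
proof
  assume "1 \<le> residual act u x"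
  then have "u \<cdot> residual act u x = u \<cdot> 1 + u \<cdot> residual act u x"
    by (metis act_add_right idempotent_semiring_class.natural_order)
  then have "u \<le> u \<cdot> residual act u x"
    by (simp add: natural_order act_one)
  also have "\<dots> \<le> x"
    unfolding residual_def act_Sup_right by (auto intro: Sup_least)
  finally show "u \<le> x" .
next
  assume "u \<le> x"
  then show "1 \<le> residual act u x"
    unfolding residual_def by (auto intro: Sup_upper simp: act_one)
qed

lemma congruence_add_act:
  assumes "congruence act W" "(f, g) \<in> W" "(a, b) \<in> W"
  shows "(f \<cdot> l + a, g \<cdot> l + b) \<in> W"
proof -
  have "prod_act act (f, g) l + prod_act act (a, b) 1 \<in> W"
    using assms unfolding congruence_def subsemimodule_def by blast
  then show ?thesis
    by (simp add: prod_act_def act_one)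
qed

lemma
  assumes "complete_congruence act W"
  shows class_top_rel: "(class_top W x, x) \<in> W"
    and class_top_ge: "x \<le> class_top W x"
proof -
  have refl: "(x, x) \<in> W"
    using assms by (auto simp: complete_congruence_def congruence_def equiv_def refl_on_def)
  then show "x \<le> class_top W x"
    unfolding class_top_def by (auto intro: Sup_upper)
  let ?Q = "(\<lambda>z. (z, x)) ` {z. (z, x) \<in> W}"
  have "?Q \<subseteq> W"
    by auto
  then have "Sup ?Q \<in> W"
    using assms unfolding complete_congruence_def complete_subsemimodule_def by blast
  \<comment> \<open>Over a nonempty index set the constant second components have supremum
    \<open>x\<close>, not bottom.\<close>
  moreover have "{z. (z, x) \<in> W} \<noteq> {}"
    using refl by auto
  ultimately show "(class_top W x, x) \<in> W"
    by (simp add: class_top_def Sup_prod_def image_image)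
qed

lemma residual_class_top_mono:
  assumes W: "complete_congruence act W" and fg: "(f, g) \<in> W"
  shows "residual act f (class_top W x) \<le> residual act g (class_top W x)"
  unfolding residual_def
proof (rule Sup_subset_mono, clarify)
  fix l
  let ?x = "class_top W x"
  assume "f \<cdot> l \<le> ?x"
  have C: "congruence act W" and E: "equiv UNIV W"
    using W by (auto simp: complete_congruence_def congruence_def)
  \<comment> \<open>Both sums are linked through \<open>g \<cdot> l + x\<close>; the second pair
    starts from \<open>(g, g)\<close>, in \<open>W\<close> by reflexivity.\<close>
  have "(f \<cdot> l + ?x, g \<cdot> l + x) \<in> W" and "(g \<cdot> l + ?x, g \<cdot> l + x) \<in> W"
    using congruence_add_act[OF C] fg class_top_rel[OF W] E
    by (auto simp: equiv_def refl_on_def)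
  with \<open>f \<cdot> l \<le> ?x\<close> have "(g \<cdot> l + ?x, ?x) \<in> W"
    using E by (metis natural_order equivE symD transD)
  then have "(g \<cdot> l + ?x, x) \<in> W"
    using class_top_rel[OF W] E by (metis equivE transD)
  then have "g \<cdot> l + ?x \<le> ?x"
    unfolding class_top_def by (auto intro: Sup_upper)
  moreover have "g \<cdot> l \<le> g \<cdot> l + ?x"
    by (simp add: natural_order add_idem flip: add.assoc)
  ultimately show "g \<cdot> l \<le> ?x"
    by (rule order_trans[rotated])
qed

lemma residual_class_top_eq:
  assumes W: "complete_congruence act W" and fg: "(f, g) \<in> W"
  shows "residual act f (class_top W x) = residual act g (class_top W x)"
proof (rule antisym)
  have "(g, f) \<in> W"
    using assms by (auto simp: complete_congruence_def congruence_def equiv_def dest: symD)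
  then show "residual act g (class_top W x) \<le> residual act f (class_top W x)"
    by (rule residual_class_top_mono[OF W])
qed (rule residual_class_top_mono[OF assms])

lemma rel_if_le_class_top:
  assumes W: "complete_congruence act W"
    and "t \<le> class_top W s" "s \<le> class_top W t"
  shows "(s, t) \<in> W"
proof -
  have C: "congruence act W" and E: "equiv UNIV W"
    using W by (auto simp: complete_congruence_def congruence_def)
  have "(t, class_top W t) \<in> W"
    using class_top_rel[OF W] E by (metis equivE symD)
  from congruence_add_act[OF C class_top_rel[OF W] this, of s 1]
  have "(class_top W s, class_top W t) \<in> W"
    using assms(2,3) by (simp add: natural_order act_one add.commute)
  then show ?thesis
    using class_top_rel[OF W] E by (metis equivE symD transD)
qed

end

theorem theorem6:
  fixes act :: "'x::{comm_monoid_add, complete_lattice} \<Rightarrow> 'k::complete_idempotent_semiring \<Rightarrow> 'x"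
    and W :: "('x \<times> 'x) set" and s t :: 'x
  assumes "complete_right_semimodule act"
    and "complete_congruence act W"
    and "(s, t) \<notin> W"
  shows "\<exists>x. (\<forall>f g. (f, g) \<in> W \<longrightarrow> residual act f x = residual act g x) \<and>
             residual act s x \<noteq> residual act t x"
proof -
  interpret complete_right_semimodule act
    by fact
  have "\<not> t \<le> class_top W s \<or> \<not> s \<le> class_top W t"
    using rel_if_le_class_top assms(2,3) by blast
  \<comment> \<open>The witness is \<open>s\<close> in the first case and \<open>t\<close> in the
    second: each lies below its own class top, the other element does not, so 1 is below only one of
    the two residuals.\<close>
  then obtain x where "residual act s (class_top W x) \<noteq> residual act t (class_top W x)"
    using class_top_ge[OF assms(2)] by (metis one_le_residual_iff)
  then show ?thesis
    using residual_class_top_eq[OF assms(2)] by blast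
qed

end
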